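(* Let $T_{a,w}$ be a distributionally chaotic weighted translation operator on $L^p(G)$, $1\le p<\infty$, and let $A,B\subset\mathbb{N}$ with $\overline{\mathrm{dens}}(A)=\overline{\mathrm{dens}}(B)=1$. Then the set $DIV_{A,B}(T_{a,w})$ is path connected.
   Context: $G$ is a second countable locally compact Hausdorff group with a right invariant Haar measure $\lambda$; $L^p(G)$ is the complex Lebesgue space with respect to $\lambda$. A weight on $G$ is a bounded continuous function $w:G\to(0,\infty)$. For $a\in G$, $(T_af)(x):=f(xa^{-1})$ and the weighted translation is $T_{a,w}f:=w\,T_af$ for $f\in L^p(G)$. For $A\subset\mathbb{N}=\{1,2,\dots\}$, $\overline{\mathrm{dens}}(A)=\limsup_{n\to\infty}\frac{\mathrm{card}(A\cap[1,n])}{n}$; $\lim_{n\in A}$ means the limit as $n\to\infty$ with $n\in A$. For an operator $T$ on a Banach space $X$ and $A,B\subset\mathbb{N}$ of upper density $1$, $DIV_{A,B}(T)=\{x\in X:\lim_{n\in A}T^nx=0\text{ and }\lim_{n\in B}\|T^nx\|=\infty\}$. $T$ is distributionally chaotic if there exist an uncountable set $\Gamma\subset X$ and $\varepsilon>0$ such that for every $\tau>0$ and every pair of distinct $x,y\in\Gamma$, $\overline{\mathrm{dens}}\{n\in\mathbb{N}:\|T^nx-T^ny\|\ge\varepsilon\}=1$ and $\overline{\mathrm{dens}}\{n\in\mathbb{N}:\|T^nx-T^ny\|<\tau\}=1$. Path connectedness is in the norm topology and means that any two points of the set are joined by a path in the set; the empty set counts as path connected. *)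

theory Defs
  imports "HOL-Analysis.Analysis"
begin

section \<open>Complex normed spaces with explicit carrier\<close>

text \<open>
  The space L^p of a measure depends on the measure and on p, hence cannot be an instance of a
  type class; its elements are values of some type and its structure is kept in a record.
\<close>

record 'v cnormed =
  vecs  :: "'v set"
  vzero :: "'v"
  vadd  :: "'v \<Rightarrow> 'v \<Rightarrow> 'v"
  vscale :: "complex \<Rightarrow> 'v \<Rightarrow> 'v"
  vnorm :: "'v \<Rightarrow> real"

definition vminus :: "('v, 'm) cnormed_scheme \<Rightarrow> 'v \<Rightarrow> 'v \<Rightarrow> 'v" where
  "vminus X x y = vadd X x (vscale X (-1) y)"

text \<open>
  The value outside the carrier is irrelevant for the topology; it is fixed because the locale
  \<open>Metric_space\<close> demands symmetry and nonnegativity for all arguments.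
\<close>

definition norm_dist :: "('v, 'm) cnormed_scheme \<Rightarrow> 'v \<Rightarrow> 'v \<Rightarrow> real" where
  "norm_dist X x y = (if x \<in> vecs X \<and> y \<in> vecs X then vnorm X (vminus X x y) else 0)"

definition norm_topology :: "('v, 'm) cnormed_scheme \<Rightarrow> 'v topology" where
  "norm_topology X = Metric_space.mtopology (vecs X) (norm_dist X)"


section \<open>Upper density, the sets DIV, distributional chaos\<close>

text \<open>The natural numbers start at 1 here; the element 0 of a set is ignored.\<close>

definition upper_density :: "nat set \<Rightarrow> ereal" where
  "upper_density A = limsup (\<lambda>n. ereal (real (card (A \<inter> {1..n})) / real n))"

definition along :: "nat set \<Rightarrow> nat filter" where
  "along A = inf sequentially (principal A)"

definition DIV :: "('v, 'm) cnormed_scheme \<Rightarrow> nat set \<Rightarrow> nat set \<Rightarrow> ('v \<Rightarrow> 'v) \<Rightarrow> 'v set" where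
  "DIV X A B T = {x \<in> vecs X.
     limitin (norm_topology X) (\<lambda>n. (T ^^ n) x) (vzero X) (along A) \<and>
     filterlim (\<lambda>n. vnorm X ((T ^^ n) x)) at_top (along B)}"

definition distributionally_chaotic :: "('v, 'm) cnormed_scheme \<Rightarrow> ('v \<Rightarrow> 'v) \<Rightarrow> bool" where
  "distributionally_chaotic X T \<longleftrightarrow>
     (\<exists>\<Gamma> \<subseteq> vecs X. uncountable \<Gamma> \<and>
       (\<exists>\<epsilon>>0. \<forall>\<tau>>0. \<forall>x\<in>\<Gamma>. \<forall>y\<in>\<Gamma>. x \<noteq> y \<longrightarrow>
          upper_density {n. n \<ge> 1 \<and> vnorm X (vminus X ((T ^^ n) x) ((T ^^ n) y)) \<ge> \<epsilon>} = 1 \<and>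
          upper_density {n. n \<ge> 1 \<and> vnorm X (vminus X ((T ^^ n) x) ((T ^^ n) y)) < \<tau>} = 1))"


section \<open>The complex space L^p of a measure\<close>

definition Lp_fun :: "'a measure \<Rightarrow> real \<Rightarrow> ('a \<Rightarrow> complex) set" where
  "Lp_fun M p = {f \<in> borel_measurable M. integrable M (\<lambda>x. norm (f x) powr p)}"

definition Lp_seminorm :: "'a measure \<Rightarrow> real \<Rightarrow> ('a \<Rightarrow> complex) \<Rightarrow> real" where
  "Lp_seminorm M p f = (\<integral>x. norm (f x) powr p \<partial>M) powr (1 / p)"

definition ae_eq :: "'a measure \<Rightarrow> real \<Rightarrow> (('a \<Rightarrow> complex) \<times> ('a \<Rightarrow> complex)) set" where
  "ae_eq M p = {(f, g). f \<in> Lp_fun M p \<and> g \<in> Lp_fun M p \<and> (AE x in M. f x = g x)}"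

definition Lp_lift ::
  "'a measure \<Rightarrow> real \<Rightarrow> (('a \<Rightarrow> complex) \<Rightarrow> ('a \<Rightarrow> complex)) \<Rightarrow>
    ('a \<Rightarrow> complex) set \<Rightarrow> ('a \<Rightarrow> complex) set" where
  "Lp_lift M p T F = (\<Union>f\<in>F. ae_eq M p `` {T f})"

text \<open>
  The seminorm is constant on each class \<open>F\<close>, so \<open>Lp_seminorm M p ` F\<close> is a singleton.
\<close>

definition Lp :: "'a measure \<Rightarrow> real \<Rightarrow> ('a \<Rightarrow> complex) set cnormed" where
  "Lp M p = \<lparr>
     vecs = Lp_fun M p // ae_eq M p,
     vzero = ae_eq M p `` {\<lambda>x. 0},
     vadd = (\<lambda>F G. \<Union>f\<in>F. \<Union>g\<in>G. ae_eq M p `` {\<lambda>x. f x + g x}),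
     vscale = (\<lambda>c. Lp_lift M p (\<lambda>f x. c * f x)),
     vnorm = (\<lambda>F. the_elem (Lp_seminorm M p ` F)) \<rparr>"


lemma equiv_ae_eq: "equiv (Lp_fun M p) (ae_eq M p)"
proof (rule equivI)
  show "ae_eq M p \<subseteq> Lp_fun M p \<times> Lp_fun M p" by (auto simp: ae_eq_def)
  show "refl_on (Lp_fun M p) (ae_eq M p)" by (auto simp: refl_on_def ae_eq_def)
  show "sym (ae_eq M p)" by (auto simp: sym_def ae_eq_def elim: AE_mp)
  show "trans (ae_eq M p)"
  proof (rule transI)
    fix f g h assume "(f, g) \<in> ae_eq M p" "(g, h) \<in> ae_eq M p"
    moreover from this have "AE x in M. f x = g x" "AE x in M. g x = h x"
      by (auto simp: ae_eq_def)
    then have "AE x in M. f x = h x" by eventually_elim simp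
    ultimately show "(f, h) \<in> ae_eq M p" by (auto simp: ae_eq_def)
  qed
qed

lemma vnorm_class:
  assumes "f \<in> Lp_fun M p"
  shows "vnorm (Lp M p) (ae_eq M p `` {f}) = Lp_seminorm M p f"
proof -
  have "Lp_seminorm M p g = Lp_seminorm M p f" if "(f, g) \<in> ae_eq M p" for g
  proof -
    have "(\<integral>x. norm (g x) powr p \<partial>M) = (\<integral>x. norm (f x) powr p \<partial>M)"
      using that by (intro integral_cong_AE) (auto simp: ae_eq_def Lp_fun_def)
    then show ?thesis by (simp add: Lp_seminorm_def)
  qed
  then have "Lp_seminorm M p ` (ae_eq M p `` {f}) \<subseteq> {Lp_seminorm M p f}" by blast
  moreover have "f \<in> ae_eq M p `` {f}" using assms by (simp add: ae_eq_def)
  ultimately have "Lp_seminorm M p ` (ae_eq M p `` {f}) = {Lp_seminorm M p f}" by blast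
  then show ?thesis by (simp add: Lp_def)
qed

lemma Lp_lift_class:
  assumes "\<And>f g. (f, g) \<in> ae_eq M p \<Longrightarrow> (T f, T g) \<in> ae_eq M p" and "f \<in> Lp_fun M p"
  shows "Lp_lift M p T (ae_eq M p `` {f}) = ae_eq M p `` {T f}"
  unfolding Lp_lift_def using equiv_ae_eq[of M p] assms
  by (intro UN_equiv_class) (auto simp: congruent_def intro!: equiv_class_eq[OF equiv_ae_eq])

lemma scale_ae_eq:
  assumes "(f, g) \<in> ae_eq M p"
  shows "((\<lambda>x. c * f x), (\<lambda>x. c * g x)) \<in> ae_eq M p"
  using assms by (auto simp: ae_eq_def Lp_fun_def norm_mult powr_mult)

lemma vscale_class:
  assumes "f \<in> Lp_fun M p"
  shows "vscale (Lp M p) c (ae_eq M p `` {f}) = ae_eq M p `` {\<lambda>x. c * f x}"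
  using Lp_lift_class[OF scale_ae_eq assms] by (simp add: Lp_def)

lemma powr_add_le:
  fixes a b :: real assumes "0 \<le> a" "0 \<le> b" "1 \<le> p"
  shows "(a + b) powr p \<le> 2 powr p * (a powr p + b powr p)"
proof -
  have "(a + b) powr p \<le> (2 * max a b) powr p"
    using assms by (intro powr_mono2) auto
  also have "\<dots> = 2 powr p * max a b powr p" using assms by (simp add: powr_mult)
  also have "\<dots> \<le> 2 powr p * (a powr p + b powr p)"
    by (intro mult_left_mono) (auto simp: max_def)
  finally show ?thesis .
qed

lemma Lp_fun_add:
  assumes "f \<in> Lp_fun M p" "g \<in> Lp_fun M p" "1 \<le> p"
  shows "(\<lambda>x. f x + g x) \<in> Lp_fun M p"
proof -
  have [measurable]: "f \<in> borel_measurable M" "g \<in> borel_measurable M"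
    using assms by (auto simp: Lp_fun_def)
  have "integrable M (\<lambda>x. norm (f x + g x) powr p)"
  proof (rule Bochner_Integration.integrable_bound)
    show "integrable M (\<lambda>x. 2 powr p * (norm (f x) powr p + norm (g x) powr p))"
      using assms by (auto simp: Lp_fun_def)
    show "AE x in M. norm (norm (f x + g x) powr p) \<le> norm (2 powr p * (norm (f x) powr p + norm (g x) powr p))"
    proof (rule AE_I2)
      fix x
      have "norm (f x + g x) powr p \<le> (norm (f x) + norm (g x)) powr p"
        using assms by (intro powr_mono2) (auto simp: norm_triangle_ineq)
      also have "\<dots> \<le> 2 powr p * (norm (f x) powr p + norm (g x) powr p)"
        using assms by (intro powr_add_le) auto
      finally show "norm (norm (f x + g x) powr p) \<le> norm (2 powr p * (norm (f x) powr p + norm (g x) powr p))"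
        by simp
    qed
  qed measurable
  then show ?thesis by (simp add: Lp_fun_def)
qed

lemma vadd_class:
  assumes "f \<in> Lp_fun M p" "g \<in> Lp_fun M p" "1 \<le> p"
  shows "vadd (Lp M p) (ae_eq M p `` {f}) (ae_eq M p `` {g}) = ae_eq M p `` {\<lambda>x. f x + g x}"
proof -
  have "(\<lambda>f g. ae_eq M p `` {\<lambda>x. f x + g x}) respects2 ae_eq M p"
  proof (rule congruent2I', rule equiv_class_eq[OF equiv_ae_eq])
    fix f f' g g' assume h: "(f, f') \<in> ae_eq M p" "(g, g') \<in> ae_eq M p"
    then have "AE x in M. f x = f' x" "AE x in M. g x = g' x" by (auto simp: ae_eq_def)
    then have "AE x in M. f x + g x = f' x + g' x" by eventually_elim simp
    with h show "((\<lambda>x. f x + g x), (\<lambda>x. f' x + g' x)) \<in> ae_eq M p"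
      using Lp_fun_add \<open>1 \<le> p\<close> by (auto simp: ae_eq_def)
  qed
  from UN_equiv_class2[OF equiv_ae_eq equiv_ae_eq this assms(1,2)]
  show ?thesis by (simp add: Lp_def)
qed

lemma vminus_class:
  assumes "f \<in> Lp_fun M p" "g \<in> Lp_fun M p" "1 \<le> p"
  shows "vminus (Lp M p) (ae_eq M p `` {f}) (ae_eq M p `` {g}) = ae_eq M p `` {\<lambda>x. f x - g x}"
proof -
  have "(\<lambda>x. -1 * g x) \<in> Lp_fun M p" using assms(2) by (simp add: Lp_fun_def)
  from vadd_class[OF assms(1) this assms(3)] show ?thesis
    by (simp add: vminus_def vscale_class[OF assms(2)] del: mult_minus_left)
qed

lemma Lp_seminorm_eq_0:
  assumes "f \<in> Lp_fun M p" 
  shows "Lp_seminorm M p f = 0 \<longleftrightarrow> (AE x in M. f x = 0)"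
proof -
  have "Lp_seminorm M p f = 0 \<longleftrightarrow> (\<integral>x. norm (f x) powr p \<partial>M) = 0" by (simp add: Lp_seminorm_def)
  also have "\<dots> \<longleftrightarrow> (AE x in M. norm (f x) powr p = 0)"
    using assms by (intro integral_nonneg_eq_0_iff_AE) (auto simp: Lp_fun_def)
  finally show ?thesis by simp
qed

lemma powr_convex_comb:
  fixes u v t :: real assumes "0 \<le> u" "0 \<le> v" "0 \<le> t" "t \<le> 1" "1 \<le> p"
  shows "((1 - t) * u + t * v) powr p \<le> (1 - t) * u powr p + t * v powr p"
proof -
  have le: "s powr p \<le> s" if "0 \<le> s" "s \<le> 1" for s :: real
    using powr_mono'[of 1 p s] that assms by (cases "s = 0") auto
  consider "u = 0" | "v = 0" | "u > 0" "v > 0" using assms by linarith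
  then show ?thesis
  proof cases
    case 1 then show ?thesis using assms le[of t] by (auto simp: powr_mult intro: mult_right_mono)
  next
    case 2 then show ?thesis using assms le[of "1 - t"] by (auto simp: powr_mult intro: mult_right_mono)
  next
    case 3 then show ?thesis
      using convex_onD[OF powr_convex[OF \<open>1 \<le> p\<close>], of t u v] assms by simp
  qed
qed

lemma Lp_seminorm_powr:
  assumes "1 \<le> p"
  shows "Lp_seminorm M p f powr p = (\<integral>x. norm (f x) powr p \<partial>M)"
  using assms by (simp add: Lp_seminorm_def powr_powr)

lemma Lp_seminorm_triangle:
  assumes f: "f \<in> Lp_fun M p" and g: "g \<in> Lp_fun M p" and p: "1 \<le> p"
  shows "Lp_seminorm M p (\<lambda>x. f x + g x) \<le> Lp_seminorm M p f + Lp_seminorm M p g"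
proof -
  let ?N = "Lp_seminorm M p"
  have m: "f \<in> borel_measurable M" "g \<in> borel_measurable M" using f g by (auto simp: Lp_fun_def)
  have nn: "0 \<le> ?N h" for h by (simp add: Lp_seminorm_def)
  show ?thesis
  proof (cases "?N f = 0 \<or> ?N g = 0")
    case True
    then show ?thesis
    proof
      assume z: "?N f = 0"
      then have "AE x in M. f x = 0" using Lp_seminorm_eq_0[OF f] by simp
      then have "(\<integral>x. norm (f x + g x) powr p \<partial>M) = (\<integral>x. norm (g x) powr p \<partial>M)"
        using m by (intro integral_cong_AE) (auto elim: AE_mp)
      then show ?thesis using z by (simp add: Lp_seminorm_def)
    next
      assume z: "?N g = 0"
      then have "AE x in M. g x = 0" using Lp_seminorm_eq_0[OF g] by simp
      then have "(\<integral>x. norm (f x + g x) powr p \<partial>M) = (\<integral>x. norm (f x) powr p \<partial>M)"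
        using m by (intro integral_cong_AE) (auto elim: AE_mp)
      then show ?thesis using z by (simp add: Lp_seminorm_def)
    qed
  next
    case False
    define a b where "a = ?N f" and "b = ?N g"
    have ab: "a > 0" "b > 0" using False nn[of f] nn[of g] by (auto simp: a_def b_def)
    define t where "t = b / (a + b)"
    have t: "0 \<le> t" "t \<le> 1" "1 - t = a / (a + b)" using ab by (auto simp: t_def field_simps)
    have pw: "norm (f x + g x) powr p \<le> (a + b) powr p *
        ((1 - t) * (norm (f x) powr p / a powr p) + t * (norm (g x) powr p / b powr p))" for x
    proof -
      have "norm (f x + g x) powr p \<le> (norm (f x) + norm (g x)) powr p"
        using p by (intro powr_mono2) (auto simp: norm_triangle_ineq)
      also have "norm (f x) + norm (g x) = (a + b) * ((1 - t) * (norm (f x) / a) + t * (norm (g x) / b))"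
      proof -
        have "(a + b) * (1 - t) = a" "(a + b) * t = b" using ab t by (auto simp: t_def)
        then have "(a + b) * ((1 - t) * (norm (f x) / a) + t * (norm (g x) / b))
          = a * (norm (f x) / a) + b * (norm (g x) / b)"
          by (metis (no_types, lifting) distrib_left mult.assoc)
        then show ?thesis using ab by simp
      qed
      also have "\<dots> powr p = (a + b) powr p * ((1 - t) * (norm (f x) / a) + t * (norm (g x) / b)) powr p"
        using ab t by (intro powr_mult) 
      also have "\<dots> \<le> (a + b) powr p * ((1 - t) * (norm (f x) / a) powr p + t * (norm (g x) / b) powr p)"
        using ab t p by (intro mult_left_mono powr_convex_comb) auto
      finally show ?thesis using ab by (simp add: powr_divide)
    qed
    have i: "integrable M (\<lambda>x. norm (f x) powr p)" "integrable M (\<lambda>x. norm (g x) powr p)"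
      using f g by (auto simp: Lp_fun_def)
    have "?N (\<lambda>x. f x + g x) powr p = (\<integral>x. norm (f x + g x) powr p \<partial>M)"
      using p by (simp add: Lp_seminorm_powr)
    also have "\<dots> \<le> (\<integral>x. (a + b) powr p *
        ((1 - t) * (norm (f x) powr p / a powr p) + t * (norm (g x) powr p / b powr p)) \<partial>M)"
      using Lp_fun_add[OF f g p] i pw by (intro integral_mono) (auto simp: Lp_fun_def)
    also have "\<dots> = (a + b) powr p * ((1 - t) * ((\<integral>x. norm (f x) powr p \<partial>M) / a powr p) + 
        t * ((\<integral>x. norm (g x) powr p \<partial>M) / b powr p))"
      using i by simp
    also have "\<dots> = (a + b) powr p"
      using ab p by (simp add: a_def b_def Lp_seminorm_powr[symmetric])
    finally have le: "?N (\<lambda>x. f x + g x) powr p \<le> (a + b) powr p" .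
    have "?N (\<lambda>x. f x + g x) \<le> a + b"
    proof (rule ccontr)
      assume "\<not> ?N (\<lambda>x. f x + g x) \<le> a + b"
      then have "(a + b) powr p < ?N (\<lambda>x. f x + g x) powr p"
        using ab p by (intro powr_less_mono2) auto
      with le show False by simp
    qed
    then show ?thesis by (simp add: a_def b_def)
  qed
qed

lemma Metric_space_Lp:
  assumes p: "1 \<le> p"
  shows "Metric_space (vecs (Lp M p)) (norm_dist (Lp M p))"
proof -
  let ?cl = "\<lambda>f. ae_eq M p `` {f}"
  have V: "vecs (Lp M p) = ?cl ` Lp_fun M p" by (auto simp: Lp_def quotient_def)
  have sub: "(\<lambda>x. f x - g x) \<in> Lp_fun M p" if "f \<in> Lp_fun M p" "g \<in> Lp_fun M p" for f g
    using Lp_fun_add[OF that(1) _ p, of "\<lambda>x. - g x"] that(2) by (simp add: Lp_fun_def)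
  have d: "norm_dist (Lp M p) (?cl f) (?cl g) = Lp_seminorm M p (\<lambda>x. f x - g x)"
    if "f \<in> Lp_fun M p" "g \<in> Lp_fun M p" for f g
    using that sub[OF that] V by (simp add: norm_dist_def vminus_class p vnorm_class)
  have junk: "norm_dist (Lp M p) F G = 0" if "F \<notin> vecs (Lp M p) \<or> G \<notin> vecs (Lp M p)" for F G
    using that by (auto simp: norm_dist_def)
  show ?thesis
  proof
    show "0 \<le> norm_dist (Lp M p) F G" for F G
      using junk[of F G] d V by (cases "F \<in> vecs (Lp M p) \<and> G \<in> vecs (Lp M p)") (auto simp: Lp_seminorm_def)
    show "norm_dist (Lp M p) F G = norm_dist (Lp M p) G F" for F G
      using junk[of F G] junk[of G F] d V
      by (cases "F \<in> vecs (Lp M p) \<and> G \<in> vecs (Lp M p)") (auto simp: Lp_seminorm_def norm_minus_commute)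
  next
    fix F G assume "F \<in> vecs (Lp M p)" "G \<in> vecs (Lp M p)"
    then obtain f g where fg: "f \<in> Lp_fun M p" "g \<in> Lp_fun M p" "F = ?cl f" "G = ?cl g"
      using V by auto
    have "F = G \<longleftrightarrow> (AE x in M. f x = g x)"
      using fg by (simp add: eq_equiv_class_iff[OF equiv_ae_eq]) (simp add: ae_eq_def)
    then show "norm_dist (Lp M p) F G = 0 \<longleftrightarrow> F = G"
      using fg Lp_seminorm_eq_0[OF sub[OF fg(1,2)]] by (simp add: d)
  next
    fix F G H assume "F \<in> vecs (Lp M p)" "G \<in> vecs (Lp M p)" "H \<in> vecs (Lp M p)"
    then obtain f g h where fg: "f \<in> Lp_fun M p" "g \<in> Lp_fun M p" "h \<in> Lp_fun M p"
       "F = ?cl f" "G = ?cl g" "H = ?cl h"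
      using V by auto
    then show "norm_dist (Lp M p) F H \<le> norm_dist (Lp M p) F G + norm_dist (Lp M p) G H"
      using Lp_seminorm_triangle[OF sub[OF fg(1,2)] sub[OF fg(2,3)] p] by (simp add: d)
  qed
qed


section \<open>Haar measure and weighted translations\<close>

text \<open>
  Groups are written additively, as in the class \<open>topological_group_add\<close>, which does not assume
  commutativity: \<open>x + a\<close> is the product of \<open>x\<close> and \<open>a\<close> in this order, and \<open>x - a\<close> is
  \<open>x + (- a)\<close>, the product of \<open>x\<close> and the inverse of \<open>a\<close>.
\<close>

text \<open>On a second countable locally compact group the two regularity clauses follow from the others.\<close>

definition right_haar_measure :: "'g::topological_group_add measure \<Rightarrow> bool" where
  "right_haar_measure M \<longleftrightarrow>
     sets M = sets borel \<and>
     emeasure M UNIV \<noteq> 0 \<and>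
     (\<forall>K. compact K \<longrightarrow> emeasure M K < \<infinity>) \<and>
     (\<forall>E\<in>sets M. emeasure M E = (INF U\<in>{U. open U \<and> E \<subseteq> U}. emeasure M U)) \<and>
     (\<forall>U. open U \<longrightarrow> emeasure M U = (SUP K\<in>{K. compact K \<and> K \<subseteq> U}. emeasure M K)) \<and>
     (\<forall>a. \<forall>E\<in>sets M. emeasure M ((\<lambda>x. x + a) ` E) = emeasure M E)"

definition weight :: "('g::topological_space \<Rightarrow> real) \<Rightarrow> bool" where
  "weight w \<longleftrightarrow> continuous_on UNIV w \<and> bounded (range w) \<and> (\<forall>x. w x > 0)"

definition translation :: "'g::group_add \<Rightarrow> ('g \<Rightarrow> complex) \<Rightarrow> 'g \<Rightarrow> complex" where
  "translation a f = (\<lambda>x. f (x - a))"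

definition weighted_translation ::
  "'g::group_add measure \<Rightarrow> real \<Rightarrow> 'g \<Rightarrow> ('g \<Rightarrow> real) \<Rightarrow>
    ('g \<Rightarrow> complex) set \<Rightarrow> ('g \<Rightarrow> complex) set" where
  "weighted_translation M p a w = Lp_lift M p (\<lambda>f x. complex_of_real (w x) * translation a f x)"

lemma weighted_translation_ae_eq:
  fixes M :: "'g::topological_group_add measure"
  assumes M: "right_haar_measure M" and w: "weight w" and p: "1 \<le> p"
    and fg: "(f, g) \<in> ae_eq M p"
  shows "((\<lambda>x. complex_of_real (w x) * translation a f x),
          (\<lambda>x. complex_of_real (w x) * translation a g x)) \<in> ae_eq M p"
proof -
  have sets: "sets M = sets borel" using M by (simp add: right_haar_measure_def)
  note [measurable_cong] = sets
  have sp: "space M = UNIV" using sets_eq_imp_space_eq[OF sets] by simp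
  have [measurable]: "(\<lambda>x::'g. x - a) \<in> borel_measurable borel"
    by (intro borel_measurable_continuous_onI continuous_intros)
  have ms [measurable]: "(\<lambda>x::'g. x - a) \<in> measurable M M"
    using sets by measurable
  have D: "distr M M (\<lambda>x. x - a) = M"
  proof (rule measure_eqI)
    fix E assume "E \<in> sets (distr M M (\<lambda>x. x - a))"
    then have E: "E \<in> sets M" by simp
    have "(\<lambda>x. x - a) -` E = (\<lambda>x. x + a) ` E"
      by (auto simp: image_iff) (metis diff_add_cancel)
    then show "emeasure (distr M M (\<lambda>x. x - a)) E = emeasure M E"
      using E M by (simp add: emeasure_distr sp right_haar_measure_def)
  qed simp
  have wm [measurable]: "w \<in> borel_measurable borel"
    using w by (auto simp: weight_def intro: borel_measurable_continuous_onI)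
  from w obtain C where C: "\<And>x. \<bar>w x\<bar> \<le> C"
    by (auto simp: weight_def bounded_iff)
  have mem: "(\<lambda>x. complex_of_real (w x) * translation a f x) \<in> Lp_fun M p" if "f \<in> Lp_fun M p" for f
  proof -
    have [measurable]: "f \<in> borel_measurable M" and i: "integrable M (\<lambda>x. norm (f x) powr p)"
      using that by (auto simp: Lp_fun_def)
    have "integrable (distr M M (\<lambda>x. x - a)) (\<lambda>x. norm (f x) powr p)" using i D by simp
    then have i2: "integrable M (\<lambda>x. norm (f (x - a)) powr p)"
      by (subst (asm) integrable_distr_eq) auto
    have "integrable M (\<lambda>x. norm (complex_of_real (w x) * f (x - a)) powr p)"
    proof (rule Bochner_Integration.integrable_bound)
      show "integrable M (\<lambda>x. C powr p * norm (f (x - a)) powr p)" using i2 by simp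
      show "AE x in M. norm (norm (complex_of_real (w x) * f (x - a)) powr p)
              \<le> norm (C powr p * norm (f (x - a)) powr p)"
        using C p by (auto simp: norm_mult powr_mult intro!: mult_right_mono powr_mono2)
    qed measurable
    then show ?thesis by (simp add: Lp_fun_def translation_def)
  qed
  have [measurable]: "f \<in> borel_measurable M" "g \<in> borel_measurable M"
    and fg': "f \<in> Lp_fun M p" "g \<in> Lp_fun M p" "AE x in M. f x = g x"
    using fg by (auto simp: ae_eq_def Lp_fun_def)
  from fg'(3) have "AE x in distr M M (\<lambda>x. x - a). f x = g x" unfolding D .
  then have "AE x in M. f (x - a) = g (x - a)"
    by (subst (asm) AE_distr_iff) auto
  then show ?thesis using mem fg' by (auto simp: ae_eq_def translation_def)
qed

lemma weighted_translation_class: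
  fixes M :: "'g::topological_group_add measure"
  assumes "right_haar_measure M" "weight w" "1 \<le> p" "f \<in> Lp_fun M p"
  shows "weighted_translation M p a w (ae_eq M p `` {f}) =
    ae_eq M p `` {\<lambda>x. complex_of_real (w x) * f (x - a)}"
  using Lp_lift_class[OF weighted_translation_ae_eq[OF assms(1-3)] assms(4)]
  by (simp add: weighted_translation_def translation_def)

end

theory Submission
  imports Defs
begin

text \<open>
  Write \<open>S\<close> for the weighted translation on functions. The weight is positive, so the modulus of
  \<open>S^n f\<close> at a point is a positive factor, independent of \<open>f\<close>, times the modulus of \<open>f\<close> at a
  translated point. Hence the size of the orbit of \<open>f\<close> depends only on \<open>|f|\<close> and is monotone in it
  (\<open>Lp_seminorm_iterate_mono\<close>). This gives a sandwich principle (\<open>DIV_sandwich\<close>): a function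
  bounded below by a multiple of \<open>|f|\<close>, with \<open>f\<close> in DIV, inherits the divergence along \<open>B\<close>; a
  function bounded above by one whose orbit is null along \<open>A\<close> inherits the nullity along \<open>A\<close>.

  Let \<open>f\<close> and \<open>g\<close> be in DIV. The function \<open>m = i (|f| + |g|)\<close> dominates both and, by the triangle
  inequality, its orbit is null along \<open>A\<close>. It therefore suffices to join \<open>f\<close> to \<open>m\<close> by line segments
  on which the modulus stays between \<open>|f| / 2\<close> and \<open>|m|\<close>. A single segment may pass through zero,
  because the phase of \<open>f\<close> may be opposite to that of \<open>m\<close>. A detour avoids this: let
  \<open>h = |f|\<close> where \<open>Re f \<ge> 0\<close> and \<open>h = - |f|\<close> elsewhere. At each point the values of \<open>f\<close> and \<open>h\<close>
  form an angle of at most a right angle, and so do those of \<open>h\<close> and \<open>m\<close>, so neither of the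
  segments from \<open>f\<close> to \<open>h\<close> and from \<open>h\<close> to \<open>m\<close> comes closer to zero than \<open>|f| / 2\<close>
  (\<open>path_to_dominating\<close>).
\<close>

section \<open>Iterates of the weighted translation of functions\<close>

definition weighted_translation_fun ::
  "'g::group_add \<Rightarrow> ('g \<Rightarrow> real) \<Rightarrow> ('g \<Rightarrow> complex) \<Rightarrow> 'g \<Rightarrow> complex" where
  "weighted_translation_fun a w f = (\<lambda>x. complex_of_real (w x) * f (x - a))"

lemma iterate_add:
  "(weighted_translation_fun a w ^^ n) (\<lambda>x. f x + g x) =
    (\<lambda>x. (weighted_translation_fun a w ^^ n) f x + (weighted_translation_fun a w ^^ n) g x)"
  by (induction n) (simp_all add: weighted_translation_fun_def algebra_simps)

lemma iterate_norm_mono: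
  assumes "\<And>x. 0 < w x" and "\<And>x. norm (f x) \<le> c * norm (g x)"
  shows "norm ((weighted_translation_fun a w ^^ n) f x)
    \<le> c * norm ((weighted_translation_fun a w ^^ n) g x)"
proof (induction n arbitrary: x)
  case 0
  show ?case using assms(2) by simp
next
  case (Suc n)
  show ?case
    using mult_left_mono[OF Suc.IH[of "x - a"] less_imp_le[OF assms(1)[of x]]] assms(1)[of x]
    by (simp add: weighted_translation_fun_def norm_mult algebra_simps)
qed

lemma iterate_Lp_fun:
  fixes M :: "'g::topological_group_add measure"
  assumes "right_haar_measure M" "weight w" "1 \<le> p" "f \<in> Lp_fun M p"
  shows "(weighted_translation_fun a w ^^ n) f \<in> Lp_fun M p"
proof (induction n)
  case 0
  show ?case using assms by simp
next
  case (Suc n)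
  then have "((weighted_translation_fun a w ^^ n) f, (weighted_translation_fun a w ^^ n) f) \<in> ae_eq M p"
    by (simp add: ae_eq_def)
  from weighted_translation_ae_eq[OF assms(1-3) this, of a] show ?case
    by (simp add: weighted_translation_fun_def[of a w "(weighted_translation_fun a w ^^ n) f"]
        translation_def ae_eq_def)
qed

lemma iterate_class:
  fixes M :: "'g::topological_group_add measure"
  assumes "right_haar_measure M" "weight w" "1 \<le> p" "f \<in> Lp_fun M p"
  shows "(weighted_translation M p a w ^^ n) (ae_eq M p `` {f}) =
    ae_eq M p `` {(weighted_translation_fun a w ^^ n) f}"
proof (induction n)
  case (Suc n)
  then show ?case
    using weighted_translation_class[OF assms(1-3) iterate_Lp_fun[OF assms, where n = n], of a]
    by (simp add: weighted_translation_fun_def[of a w "(weighted_translation_fun a w ^^ n) f"])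
qed simp

lemma Lp_seminorm_mono:
  assumes "f \<in> Lp_fun M p" "g \<in> Lp_fun M p" "1 \<le> p" and "0 \<le> c"
    and le: "\<And>x. norm (f x) \<le> c * norm (g x)"
  shows "Lp_seminorm M p f \<le> c * Lp_seminorm M p g"
proof -
  have "(\<integral>x. norm (f x) powr p \<partial>M) \<le> (\<integral>x. c powr p * norm (g x) powr p \<partial>M)"
  proof (rule integral_mono)
    show "norm (f x) powr p \<le> c powr p * norm (g x) powr p" for x
      using powr_mono2[OF _ norm_ge_zero le[of x], of p] assms by (simp add: powr_mult)
  qed (use assms in \<open>auto simp: Lp_fun_def\<close>)
  then have "Lp_seminorm M p f \<le> (c powr p * (\<integral>x. norm (g x) powr p \<partial>M)) powr (1 / p)"
    unfolding Lp_seminorm_def using assms by (intro powr_mono2) auto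
  also have "\<dots> = c * Lp_seminorm M p g"
    using assms by (simp add: Lp_seminorm_def powr_mult powr_powr)
  finally show ?thesis .
qed

lemma Lp_seminorm_iterate_mono:
  fixes M :: "'g::topological_group_add measure"
  assumes M: "right_haar_measure M" "weight w" "1 \<le> p"
    and "f \<in> Lp_fun M p" "g \<in> Lp_fun M p" and "0 \<le> c"
    and "\<And>x. norm (f x) \<le> c * norm (g x)"
  shows "Lp_seminorm M p ((weighted_translation_fun a w ^^ n) f)
    \<le> c * Lp_seminorm M p ((weighted_translation_fun a w ^^ n) g)"
  using assms by (intro Lp_seminorm_mono iterate_norm_mono iterate_Lp_fun) (auto simp: weight_def)


section \<open>Membership in DIV\<close>

lemma Lp_fun_scale: "f \<in> Lp_fun M p \<Longrightarrow> (\<lambda>x. c * f x) \<in> Lp_fun M p"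
  by (auto simp: Lp_fun_def norm_mult powr_mult)

lemma zero_Lp_fun: "(\<lambda>x. 0) \<in> Lp_fun M p"
  by (simp add: Lp_fun_def)

lemma vecs_Lp: "vecs (Lp M p) = (\<lambda>f. ae_eq M p `` {f}) ` Lp_fun M p"
  by (auto simp: Lp_def quotient_def)

lemma norm_dist_class:
  assumes "f \<in> Lp_fun M p" "g \<in> Lp_fun M p" "1 \<le> p"
  shows "norm_dist (Lp M p) (ae_eq M p `` {f}) (ae_eq M p `` {g})
    = Lp_seminorm M p (\<lambda>x. f x - g x)"
proof -
  have "(\<lambda>x. f x - g x) \<in> Lp_fun M p"
    using Lp_fun_add[OF assms(1) Lp_fun_scale[OF assms(2), of "-1"] assms(3)] by simp
  then show ?thesis
    using assms by (simp add: norm_dist_def vecs_Lp vminus_class vnorm_class)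
qed

lemma DIV_class_iff:
  fixes M :: "'g::topological_group_add measure" and a :: 'g
  assumes M: "right_haar_measure M" "weight w" "1 \<le> p" and f: "f \<in> Lp_fun M p"
  defines "N \<equiv> \<lambda>n. Lp_seminorm M p ((weighted_translation_fun a w ^^ n) f)"
  shows "ae_eq M p `` {f} \<in> DIV (Lp M p) A B (weighted_translation M p a w) \<longleftrightarrow>
    (N \<longlongrightarrow> 0) (along A) \<and> filterlim N at_top (along B)"
proof -
  interpret Metric_space "vecs (Lp M p)" "norm_dist (Lp M p)"
    by (rule Metric_space_Lp[OF M(3)])
  let ?x = "\<lambda>n. ae_eq M p `` {(weighted_translation_fun a w ^^ n) f}"
  note it = iterate_Lp_fun[OF M f, where a = a]
  have z: "vzero (Lp M p) = ae_eq M p `` {\<lambda>x. 0}" by (simp add: Lp_def)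
  have vecs: "ae_eq M p `` {f} \<in> vecs (Lp M p)" "vzero (Lp M p) \<in> vecs (Lp M p)"
    "?x n \<in> vecs (Lp M p)" for n
    unfolding z vecs_Lp using f it zero_Lp_fun by blast+
  have dist: "norm_dist (Lp M p) (?x n) (vzero (Lp M p)) = N n" for n
    unfolding z using norm_dist_class[OF it zero_Lp_fun M(3)] by (simp add: N_def)
  have norm: "vnorm (Lp M p) (?x n) = N n" for n
    unfolding N_def by (rule vnorm_class[OF it])
  have "limitin mtopology ?x (vzero (Lp M p)) (along A) \<longleftrightarrow> (N \<longlongrightarrow> 0) (along A)"
    unfolding limitin_metric_dist_null dist using vecs by simp
  then show ?thesis
    unfolding DIV_def norm_topology_def mem_Collect_eq iterate_class[OF M f] norm
    using vecs by simp
qed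

lemma DIV_sandwich:
  fixes M :: "'g::topological_group_add measure"
  assumes M: "right_haar_measure M" "weight w" "1 \<le> p"
    and f: "f \<in> Lp_fun M p" and h: "h \<in> Lp_fun M p" and m: "m \<in> Lp_fun M p"
    and D: "ae_eq M p `` {f} \<in> DIV (Lp M p) A B (weighted_translation M p a w)"
    and null: "((\<lambda>n. Lp_seminorm M p ((weighted_translation_fun a w ^^ n) m)) \<longlongrightarrow> 0) (along A)"
    and lower: "\<And>x. norm (f x) \<le> 2 * norm (h x)"
    and upper: "\<And>x. norm (h x) \<le> norm (m x)"
  shows "ae_eq M p `` {h} \<in> DIV (Lp M p) A B (weighted_translation M p a w)"
proof -
  define N where "N u n = Lp_seminorm M p ((weighted_translation_fun a w ^^ n) u)" for u n
  have up: "N h n \<le> N m n" for n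
    using Lp_seminorm_iterate_mono[OF M h m, of 1] upper by (simp add: N_def)
  have lo: "N f n \<le> 2 * N h n" for n
    using Lp_seminorm_iterate_mono[OF M f h, of 2] lower by (simp add: N_def)
  have nonneg: "0 \<le> N h n" for n by (simp add: N_def Lp_seminorm_def)
  have "filterlim (N f) at_top (along B)"
    using D DIV_class_iff[OF M f] by (simp add: N_def[abs_def])
  then have "filterlim (\<lambda>n. (1 / 2) * N f n) at_top (along B)"
    by (intro filterlim_tendsto_pos_mult_at_top[OF tendsto_const]) auto
  then have "filterlim (N h) at_top (along B)"
    by (rule filterlim_at_top_mono) (use lo in \<open>simp add: mult.commute\<close>)
  moreover have "(N h \<longlongrightarrow> 0) (along A)"
    by (rule tendsto_sandwich[OF _ _ tendsto_const null[folded N_def]]) (use nonneg up in auto)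
  ultimately show ?thesis using DIV_class_iff[OF M h] by (simp add: N_def[abs_def])
qed


section \<open>Paths in DIV\<close>

lemma segment_path_component:
  fixes f g :: "'a \<Rightarrow> complex"
  assumes f: "f \<in> Lp_fun M p" and g: "g \<in> Lp_fun M p" and p: "1 \<le> p"
    and D: "\<And>t. 0 \<le> t \<Longrightarrow> t \<le> 1 \<Longrightarrow>
      ae_eq M p `` {\<lambda>x. complex_of_real (1 - t) * f x + complex_of_real t * g x} \<in> D"
  shows "path_component_of (subtopology (norm_topology (Lp M p)) D)
    (ae_eq M p `` {f}) (ae_eq M p `` {g})"
proof -
  interpret Metric_space "vecs (Lp M p)" "norm_dist (Lp M p)"
    by (rule Metric_space_Lp[OF p])
  define c where "c t = (\<lambda>x. complex_of_real (1 - t) * f x + complex_of_real t * g x)" for t :: real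
  define d where "d = (\<lambda>x. f x - g x)"
  have c: "c t \<in> Lp_fun M p" for t
    unfolding c_def by (intro Lp_fun_add Lp_fun_scale f g p)
  have cl: "ae_eq M p `` {c t} \<in> vecs (Lp M p)" for t
    unfolding vecs_Lp using c by blast
  have d: "d \<in> Lp_fun M p"
    using Lp_fun_add[OF f Lp_fun_scale[OF g, of "-1"] p] by (simp add: d_def)
  have lip: "norm_dist (Lp M p) (ae_eq M p `` {c s}) (ae_eq M p `` {c t})
      \<le> \<bar>s - t\<bar> * Lp_seminorm M p d" for s t
  proof -
    have diff: "(\<lambda>x. c s x - c t x) = (\<lambda>x. complex_of_real (t - s) * d x)"
      by (simp add: c_def d_def algebra_simps)
    have "Lp_seminorm M p (\<lambda>x. complex_of_real (t - s) * d x) \<le> \<bar>s - t\<bar> * Lp_seminorm M p d"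
      by (rule Lp_seminorm_mono[OF Lp_fun_scale[OF d] d p])
        (auto simp: norm_mult abs_minus_commute simp del: of_real_diff)
    then show ?thesis using norm_dist_class[OF c c p] diff by simp
  qed
  have "pathin (norm_topology (Lp M p)) (\<lambda>t. ae_eq M p `` {c t})"
    unfolding pathin_def norm_topology_def continuous_map_to_metric
  proof (intro ballI allI impI)
    fix t e :: real
    assume t: "t \<in> topspace (top_of_set {0..1})" and e: "0 < e"
    \<comment> \<open>The summand 1 keeps the radius positive when the two endpoints coincide.\<close>
    define r where "r = e / (Lp_seminorm M p d + 1)"
    have pos: "0 < Lp_seminorm M p d + 1"
      by (simp add: Lp_seminorm_def add_nonneg_pos)
    have "ae_eq M p `` {c s} \<in> mball (ae_eq M p `` {c t}) e" if "s \<in> {0..1} \<inter> ball t r" for s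
    proof -
      have "\<bar>t - s\<bar> * Lp_seminorm M p d \<le> \<bar>t - s\<bar> * (Lp_seminorm M p d + 1)"
        by (intro mult_left_mono) auto
      also have "\<dots> < e"
        using that pos by (simp add: r_def dist_real_def pos_less_divide_eq)
      finally show ?thesis
        using lip[of t s] cl by simp
    qed
    moreover have "t \<in> {0..1} \<inter> ball t r" using t e pos by (simp add: r_def)
    ultimately show "\<exists>U. openin (top_of_set {0..1}) U \<and> t \<in> U \<and>
        (\<forall>s\<in>U. ae_eq M p `` {c s} \<in> mball (ae_eq M p `` {c t}) e)"
      by (intro exI[of _ "{0..1} \<inter> ball t r"]) auto
  qed
  then show ?thesis
    unfolding path_component_of_def pathin_subtopology
    using D by (intro exI[of _ "\<lambda>t. ae_eq M p `` {c t}"]) (auto simp: c_def)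
qed

text \<open>
  At an angle of at most a right angle a sum is at least as long as each of its summands
  \<open>(1 - t) u\<close> and \<open>t v\<close>; adding the two bounds gives the claim.
\<close>

lemma norm_segment_ge_half:
  fixes u v :: "'a::real_inner"
  assumes "0 \<le> u \<bullet> v" and "norm u \<le> norm v" and "0 \<le> t" "t \<le> 1"
  shows "norm u \<le> 2 * norm ((1 - t) *\<^sub>R u + t *\<^sub>R v)"
proof -
  have sq: "(norm ((1 - t) *\<^sub>R u + t *\<^sub>R v))\<^sup>2
      = ((1 - t) * norm u)\<^sup>2 + (t * norm v)\<^sup>2 + 2 * ((1 - t) * t * (u \<bullet> v))"
    unfolding power_mult_distrib power2_norm_eq_inner
    by (simp add: inner_commute inner_left_distrib inner_right_distrib algebra_simps power2_eq_square)
  have nn: "0 \<le> (1 - t) * t * (u \<bullet> v)" using assms by simp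
  have "(1 - t) * norm u \<le> norm ((1 - t) *\<^sub>R u + t *\<^sub>R v)"
    by (rule power2_le_imp_le) (use sq nn in auto)
  moreover have "t * norm v \<le> norm ((1 - t) *\<^sub>R u + t *\<^sub>R v)"
    by (rule power2_le_imp_le) (use sq nn in auto)
  moreover have "t * norm u \<le> t * norm v" using assms by (simp add: mult_left_mono)
  ultimately show ?thesis by (simp add: algebra_simps)
qed

text \<open>
  The values of \<open>m\<close> are purely imaginary, hence orthogonal to those of the real detour function \<open>h\<close>;
  this lets the second segment avoid zero whatever signs \<open>h\<close> takes.
\<close>

lemma path_to_dominating:
  fixes M :: "'g::topological_group_add measure"
  assumes M: "right_haar_measure M" "weight w" "1 \<le> p"
    and f: "f \<in> Lp_fun M p" and m: "m \<in> Lp_fun M p"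
    and D: "ae_eq M p `` {f} \<in> DIV (Lp M p) A B (weighted_translation M p a w)"
    and null: "((\<lambda>n. Lp_seminorm M p ((weighted_translation_fun a w ^^ n) m)) \<longlongrightarrow> 0) (along A)"
    and le: "\<And>x. norm (f x) \<le> norm (m x)" and Re: "\<And>x. Re (m x) = 0"
  shows "path_component_of
    (subtopology (norm_topology (Lp M p)) (DIV (Lp M p) A B (weighted_translation M p a w)))
    (ae_eq M p `` {f}) (ae_eq M p `` {m})"
proof -
  define h where "h x = complex_of_real (if 0 \<le> Re (f x) then norm (f x) else - norm (f x))" for x
  have norm_h: "norm (h x) = norm (f x)" for x by (simp add: h_def)
  have [measurable]: "f \<in> borel_measurable M" using f by (simp add: Lp_fun_def)
  have h: "h \<in> Lp_fun M p"
  proof -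
    have "h \<in> borel_measurable M" unfolding h_def by measurable
    then show ?thesis using f by (simp add: Lp_fun_def norm_h)
  qed
  have angle_f: "0 \<le> f x \<bullet> h x" for x by (simp add: inner_complex_def h_def mult_nonpos_nonneg)
  have angle_m: "0 \<le> h x \<bullet> m x" for x by (simp add: inner_complex_def h_def Re)
  have seg: "path_component_of
      (subtopology (norm_topology (Lp M p)) (DIV (Lp M p) A B (weighted_translation M p a w)))
      (ae_eq M p `` {u}) (ae_eq M p `` {v})"
    if u: "u \<in> Lp_fun M p" and v: "v \<in> Lp_fun M p"
      and eq: "\<And>x. norm (u x) = norm (f x)" and uv: "\<And>x. norm (u x) \<le> norm (v x)"
      and vm: "\<And>x. norm (v x) \<le> norm (m x)" and angle: "\<And>x. 0 \<le> u x \<bullet> v x"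
    for u v
  proof (rule segment_path_component[OF u v M(3)])
    fix t :: real assume t: "0 \<le> t" "t \<le> 1"
    define c where "c = (\<lambda>x. complex_of_real (1 - t) * u x + complex_of_real t * v x)"
    have c: "c \<in> Lp_fun M p" unfolding c_def by (intro Lp_fun_add Lp_fun_scale u v M(3))
    have scale: "c x = (1 - t) *\<^sub>R u x + t *\<^sub>R v x" for x
      by (simp add: c_def scaleR_conv_of_real)
    have lower: "norm (f x) \<le> 2 * norm (c x)" for x
      unfolding scale eq[symmetric] by (rule norm_segment_ge_half[OF angle uv t])
    have upper: "norm (c x) \<le> norm (m x)" for x
    proof -
      have "norm (c x) \<le> (1 - t) * norm (u x) + t * norm (v x)"
        unfolding scale using t norm_triangle_ineq[of "(1 - t) *\<^sub>R u x" "t *\<^sub>R v x"] by simp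
      also have "\<dots> \<le> (1 - t) * norm (m x) + t * norm (m x)"
        using t uv[of x] vm[of x] by (intro add_mono mult_left_mono) auto
      finally show ?thesis by (simp add: algebra_simps)
    qed
    show "ae_eq M p `` {\<lambda>x. complex_of_real (1 - t) * u x + complex_of_real t * v x}
        \<in> DIV (Lp M p) A B (weighted_translation M p a w)"
      using DIV_sandwich[OF M f c m D null lower upper] unfolding c_def .
  qed
  show ?thesis
    using path_component_of_trans[OF seg[OF f h] seg[OF h m]] le norm_h angle_f angle_m by simp
qed

theorem corollary3p9:
  fixes \<mu> :: "'g :: {topological_group_add, t2_space, second_countable_topology} measure"
    and w :: "'g \<Rightarrow> real" and a :: 'g and p :: real and A B :: "nat set"
  assumes "locally_compact_space (euclidean :: 'g topology)"
    and "right_haar_measure \<mu>"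
    and "1 \<le> p"
    and "weight w"
    and "distributionally_chaotic (Lp \<mu> p) (weighted_translation \<mu> p a w)"
    and "A \<subseteq> {1..}" and "B \<subseteq> {1..}"
    and "upper_density A = 1" and "upper_density B = 1"
  shows "path_connectedin (norm_topology (Lp \<mu> p))
           (DIV (Lp \<mu> p) A B (weighted_translation \<mu> p a w))"
proof -
  note M = assms(2,4,3)
  let ?D = "DIV (Lp \<mu> p) A B (weighted_translation \<mu> p a w)"
  interpret Metric_space "vecs (Lp \<mu> p)" "norm_dist (Lp \<mu> p)"
    by (rule Metric_space_Lp[OF M(3)])
  have sub: "?D \<subseteq> vecs (Lp \<mu> p)" by (auto simp: DIV_def)
  have top: "topspace (norm_topology (Lp \<mu> p)) = vecs (Lp \<mu> p)" by (simp add: norm_topology_def)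
  have "path_component_of (subtopology (norm_topology (Lp \<mu> p)) ?D) F G"
    if FG: "F \<in> ?D" "G \<in> ?D" for F G
  proof -
    from FG sub obtain f g where f: "f \<in> Lp_fun \<mu> p" and g: "g \<in> Lp_fun \<mu> p"
      and F: "F = ae_eq \<mu> p `` {f}" and G: "G = ae_eq \<mu> p `` {g}"
      unfolding vecs_Lp by blast
    define im where "im u = (\<lambda>x. \<i> * complex_of_real (norm (u x)))" for u :: "'g \<Rightarrow> complex"
    define m where "m = (\<lambda>x. im f x + im g x)"
    define N where "N u n = Lp_seminorm \<mu> p ((weighted_translation_fun a w ^^ n) u)" for u n
    have im: "im u \<in> Lp_fun \<mu> p" if "u \<in> Lp_fun \<mu> p" for u
    proof -
      have [measurable]: "u \<in> borel_measurable \<mu>" using that by (simp add: Lp_fun_def)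
      have "im u \<in> borel_measurable \<mu>" unfolding im_def by measurable
      then show ?thesis using that by (simp add: im_def Lp_fun_def norm_mult)
    qed
    have m: "m \<in> Lp_fun \<mu> p"
      unfolding m_def by (intro Lp_fun_add im f g M(3))
    have norm_m: "norm (m x) = norm (f x) + norm (g x)" for x
    proof -
      have "m x = \<i> * complex_of_real (norm (f x) + norm (g x))"
        by (simp add: m_def im_def distrib_left)
      then show ?thesis by (simp add: norm_mult del: of_real_add)
    qed
    have Re: "Re (m x) = 0" for x by (simp add: m_def im_def)
    have N_im: "N (im u) n \<le> N u n" if "u \<in> Lp_fun \<mu> p" for u n
      using Lp_seminorm_iterate_mono[OF M im[OF that] that, of 1]
      by (simp add: N_def im_def norm_mult)
    have N_m: "N m n \<le> N f n + N g n" for n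
    proof -
      have "N m n \<le> N (im f) n + N (im g) n"
        unfolding N_def m_def iterate_add
        by (intro Lp_seminorm_triangle iterate_Lp_fun M im f g)
      then show ?thesis using N_im[OF f, of n] N_im[OF g, of n] by linarith
    qed
    have "(N f \<longlongrightarrow> 0) (along A)" "(N g \<longlongrightarrow> 0) (along A)"
      using FG DIV_class_iff[OF M f] DIV_class_iff[OF M g] by (simp_all add: F G N_def[abs_def])
    then have "((\<lambda>n. N f n + N g n) \<longlongrightarrow> 0) (along A)"
      by (rule tendsto_add_zero)
    then have null: "(N m \<longlongrightarrow> 0) (along A)"
      by (rule tendsto_sandwich[OF _ _ tendsto_const, rotated 2])
        (use N_m in \<open>auto simp: N_def Lp_seminorm_def\<close>)
    note join = path_to_dominating[OF M _ m _ null[unfolded N_def[abs_def]] _ Re]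
    have "path_component_of (subtopology (norm_topology (Lp \<mu> p)) ?D) F (ae_eq \<mu> p `` {m})"
      unfolding F by (rule join[OF f]) (use FG F norm_m in auto)
    moreover have "path_component_of (subtopology (norm_topology (Lp \<mu> p)) ?D) G (ae_eq \<mu> p `` {m})"
      unfolding G by (rule join[OF g]) (use FG G norm_m in auto)
    ultimately show ?thesis
      using path_component_of_trans path_component_of_sym by fast
  qed
  then have "path_connected_space (subtopology (norm_topology (Lp \<mu> p)) ?D)"
    unfolding path_connected_space_iff_path_component by simp
  then show ?thesis
    unfolding path_connectedin_def using sub top by simp
qed

end
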